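(* There is an absolute constant $C_2>0$ such that the following holds. Let $n,d,d_0$ be positive integers with $d_0\le d$ and $2\le d_0\log_2\left(\frac{2d}{d_0}\right)\le n$. Consider the $d_0$-sparse agnostic logistic regression model with fixed design. Then there exists a design matrix $X_0\in\mathbb{R}^{n\times d}$ such that $$\inf_{\tilde\eta}\ \sup_{\eta^*\in\mathcal{C}(d_0)}\mathcal{E}_{X_0}(\tilde\eta,\eta^* )\ \ge\ C_2\sqrt{\frac{d_0\ln\frac{de}{d_0}}{n}},$$ where the infimum is taken over all classifiers $\tilde\eta$ based on the data $(X_0,\mathbf{Y})$, and the supremum is over the Bayes classifiers $\eta^*(\mathbf{x})=I\{\boldsymbol\beta^t\mathbf{x}\ge0\}$ of the models with $\boldsymbol\beta\in\mathbb{R}^d$, $\|\boldsymbol\beta\|_0\le d_0$.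
   Context: Logistic regression with fixed design $X\in\mathbb{R}^{n\times d}$ (rows $\mathbf{x}_1,\dots,\mathbf{x}_n$): $Y_1,\dots,Y_n$ are independent, $Y_i\sim Bin(1,p_i)$, $\ln\frac{p_i}{1-p_i}=\boldsymbol\beta^t\mathbf{x}_i$; $\mathbf{Y}=(Y_1,\dots,Y_n)$. It is $d_0$-sparse if $\|\boldsymbol\beta\|_0\le d_0$, where $\|\boldsymbol\beta\|_0$ is the number of nonzero entries. "Agnostic" means that the Bayes classifier is not perfect, i.e. its misclassification error is positive. $\mathcal{C}(d_0)=\{\eta(\mathbf{x})=I\{\boldsymbol\beta^t\mathbf{x}\ge0\}:\boldsymbol\beta\in\mathbb{R}^d,\|\boldsymbol\beta\|_0\le d_0\}$. For a classifier $\eta$, $R_X(\eta)=\frac1n\sum_{i=1}^nP(Y_i\ne\eta(\mathbf{x}_i))$; for a classifier $\tilde\eta$ built from the data it is the conditional error given the data, where the $Y_i$ to be predicted are new independent $Bin(1,p_i)$ variables. The misclassification excess risk is $\mathcal{E}_X(\tilde\eta,\eta^* )=ER_X(\tilde\eta)-R_X(\eta^* )$ with $\eta^*(\mathbf{x})=I\{\boldsymbol\beta^t\mathbf{x}\ge0\}$ for the true $\boldsymbol\beta$; equivalently $\mathcal{E}_X(\tilde\eta,\eta^* )=\frac1n\sum_{i=1}^nP(\tilde\eta(\mathbf{x}_i)\ne\eta^*(\mathbf{x}_i))|2p_i-1|$. *)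

theory Defs
  imports "HOL-Probability.Probability" "Jordan_Normal_Form.Matrix"
begin

unbundle no inner_syntax
unbundle no vec_syntax

definition logit :: "real \<Rightarrow> real" where
  "logit p = ln (p / (1 - p))"

definition success_prob :: "real mat \<Rightarrow> real vec \<Rightarrow> nat \<Rightarrow> real" where
  "success_prob X \<beta> i = (THE p. 0 < p \<and> p < 1 \<and> logit p = \<beta> \<bullet> row X i)"

lemma logit_eq_iff:
  assumes "0 < p" "p < 1"
  shows "logit p = t \<longleftrightarrow> p = 1 / (1 + exp (- t))"
proof -
  have "logit p = t \<longleftrightarrow> p / (1 - p) = exp t"
    using assms by (auto simp: logit_def)
  also have "\<dots> \<longleftrightarrow> p * (1 + exp t) = exp t"
    using assms by (auto simp: field_simps)
  also have "\<dots> \<longleftrightarrow> p = exp t / (1 + exp t)"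
    by (subst nonzero_eq_divide_eq) (auto simp: add_pos_pos less_imp_neq[symmetric])
  also have "exp t / (1 + exp t) = 1 / (1 + exp (- t))"
    using exp_gt_zero[of t] by (simp add: exp_minus divide_simps)
  finally show ?thesis .
qed

lemma success_prob_eq: "success_prob X \<beta> i = 1 / (1 + exp (- (\<beta> \<bullet> row X i)))"
proof -
  have bounds: "0 < 1 / (1 + exp (- t))" "1 / (1 + exp (- t)) < 1" for t :: real
    by (simp_all add: add_pos_pos)
  show ?thesis
    unfolding success_prob_def
    by (rule the_equality) (use bounds logit_eq_iff in auto)
qed

lemma success_prob_bounds: "0 < success_prob X \<beta> i" "success_prob X \<beta> i < 1"
  by (simp_all add: success_prob_eq add_pos_pos)

text \<open>
  The joint law of the labels \<open>Y\<^sub>0, \<dots>, Y\<^sub>n\<^sub>-\<^sub>1\<close>, where \<^term>\<open>True\<close> stands for the label 1. Indices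
  outside the sample carry the dummy value \<^term>\<open>False\<close> almost surely, so a function of the labels
  is a function on the finite set of binary vectors of length \<open>n\<close>.
\<close>

definition label_pmf :: "real mat \<Rightarrow> real vec \<Rightarrow> (nat \<Rightarrow> bool) pmf" where
  "label_pmf X \<beta> = Pi_pmf {..<dim_row X} False (\<lambda>i. bernoulli_pmf (success_prob X \<beta> i))"

type_synonym classifier = "real vec \<Rightarrow> bool"

definition bayes_classifier :: "real vec \<Rightarrow> classifier" where
  "bayes_classifier \<beta> x \<longleftrightarrow> \<beta> \<bullet> x \<ge> 0"

definition risk :: "real mat \<Rightarrow> real vec \<Rightarrow> classifier \<Rightarrow> real" where
  "risk X \<beta> \<eta> =
     (\<Sum>i<dim_row X. measure_pmf.prob (label_pmf X \<beta>) {y. y i \<noteq> \<eta> (row X i)}) / real (dim_row X)"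

text \<open>
  A data-based classifier at a fixed design maps the observed labels to a classifier. Its risk is
  evaluated on labels drawn afresh from \<^const>\<open>label_pmf\<close> (inside \<^const>\<open>risk\<close>) and then averaged
  over the observed labels.
\<close>

definition excess_risk :: "real mat \<Rightarrow> real vec \<Rightarrow> ((nat \<Rightarrow> bool) \<Rightarrow> classifier) \<Rightarrow> real" where
  "excess_risk X \<beta> \<eta>t =
     measure_pmf.expectation (label_pmf X \<beta>) (\<lambda>y. risk X \<beta> (\<eta>t y)) - risk X \<beta> (bayes_classifier \<beta>)"

definition l0_norm :: "real vec \<Rightarrow> nat" where
  "l0_norm \<beta> = card {j. j < dim_vec \<beta> \<and> \<beta> $ j \<noteq> 0}"

text \<open>
  The last condition says that the model is agnostic. The logistic model with a finite coefficient
  vector satisfies it whenever the sample is nonempty, see \<open>bayes_risk_pos\<close> below.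
\<close>

definition sparse_agnostic :: "real mat \<Rightarrow> nat \<Rightarrow> real vec set" where
  "sparse_agnostic X d\<^sub>0 =
     {\<beta> \<in> carrier_vec (dim_col X). l0_norm \<beta> \<le> d\<^sub>0 \<and> risk X \<beta> (bayes_classifier \<beta>) > 0}"

lemma prob_label:
  assumes "i < dim_row X"
  shows "measure_pmf.prob (label_pmf X \<beta>) {y. y i \<noteq> b} =
     (if b then 1 - success_prob X \<beta> i else success_prob X \<beta> i)"
proof -
  have "map_pmf (\<lambda>y. y i) (label_pmf X \<beta>) = bernoulli_pmf (success_prob X \<beta> i)"
    using assms unfolding label_pmf_def by (subst Pi_pmf_component) auto
  hence "measure_pmf.prob (label_pmf X \<beta>) {y. y i \<noteq> b} =
      measure_pmf.prob (bernoulli_pmf (success_prob X \<beta> i)) {\<not> b}"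
    by (subst (asm) eq_commute) (auto intro!: arg_cong2[where f = measure_pmf.prob])
  thus ?thesis
    using success_prob_bounds[of X \<beta> i] by (cases b) (auto simp: measure_pmf_single)
qed

lemma bayes_risk_pos:
  assumes "0 < dim_row X"
  shows "risk X \<beta> (bayes_classifier \<beta>) > 0"
proof -
  have "0 < measure_pmf.prob (label_pmf X \<beta>) {y. y i \<noteq> b}" if "i < dim_row X" for i b
    using success_prob_bounds[of X \<beta> i] by (subst prob_label[OF that]) auto
  thus ?thesis
    unfolding risk_def using assms by (intro divide_pos_pos sum_pos) auto
qed

end

theory Submission
  imports Defs
begin

text \<open>
  Assouad's method. Let \<open>L = \<lfloor>log\<^sub>2 (2 d / d\<^sub>0)\<rfloor>\<close> and \<open>V = d\<^sub>0 L\<close>. There are \<open>V\<close> points such that every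
  labelling of them is realised, with one and the same margin, by a \<open>d\<^sub>0\<close>-sparse coefficient vector. The
  design repeats them cyclically, and scaling the coefficients makes all success probabilities equal
  to \<open>(1 \<plusminus> \<delta>) / 2\<close> with \<open>\<delta> = \<surd>(V / (4 n))\<close>. A point then occurs at most \<open>2 n / V\<close> times, so the
  observed labels cannot tell the two values of its Bayes label apart reliably. Averaged over all
  labellings, any classifier errs on each row with probability at least \<open>1/8\<close>, each error costing \<open>\<delta>\<close>.
\<close>

section \<open>Two-point testing for product Bernoulli laws\<close>

text \<open>Put \<open>s = p + q\<close>. Since \<open>s\<close> dominates the maximum,
  \<open>min p q * s\<close> is at least \<open>p * q\<close>; and
  \<open>(m - s / 2)\<^sup>2 \<ge> 0\<close> gives \<open>(m - s / 4) * s \<le> m\<^sup>2\<close>.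
  The bound is linear in \<open>p\<close>, \<open>q\<close> and \<open>m\<close>, so it can be
  summed over outcomes.\<close>

lemma min_ge_square:
  fixes p q m a :: real
  assumes "0 \<le> p" "0 \<le> q" "0 \<le> a" "p * q = a * m\<^sup>2"
  shows "min p q \<ge> a * (m - (p + q) / 4)"
proof (cases "p + q = 0")
  case True
  then have "p = 0" "q = 0" using assms(1,2) by linarith+
  then have "a = 0 \<or> m = 0" using assms by simp
  then show ?thesis using \<open>p = 0\<close> \<open>q = 0\<close> by auto
next
  case False
  then have s: "p + q > 0" using assms by auto
  have "min p q * (p + q) \<ge> p * q"
    using assms by (cases "p \<le> q") (auto simp: min_def algebra_simps)
  moreover have "a * (m - (p + q) / 4) * (p + q) \<le> a * m\<^sup>2"
  proof -
    have "(m - (p + q) / 4) * (p + q) = m\<^sup>2 - (m - (p + q) / 2)\<^sup>2"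
      by (simp add: power2_eq_square field_simps)
    also have "\<dots> \<le> m\<^sup>2" by simp
    finally show ?thesis using assms(3) by (simp add: mult.assoc mult_left_mono)
  qed
  ultimately have "a * (m - (p + q) / 4) * (p + q) \<le> min p q * (p + q)"
    using assms by simp
  then show ?thesis using s by simp
qed

text \<open>
  The hypothesis says that \<open>a\<close> is the squared Hellinger affinity and that \<open>M\<close> is the normalised
  geometric mean of \<open>P\<close> and \<open>Q\<close>; naming \<open>M\<close> avoids square roots and the Cauchy--Schwarz inequality.
\<close>

lemma two_point_testing:
  fixes P Q M :: "'a pmf" and a :: real
  assumes fin: "finite (set_pmf P)" "finite (set_pmf Q)" "finite (set_pmf M)"
    and a: "0 \<le> a" and PQ: "\<And>y. pmf P y * pmf Q y = a * (pmf M y)\<^sup>2"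
  shows "measure_pmf.prob P {y. T y} + measure_pmf.prob Q {y. \<not> T y} \<ge> a / 2"
proof -
  define A where "A = set_pmf P \<union> set_pmf Q \<union> set_pmf M"
  have A: "finite A" using fin by (simp add: A_def)
  have prob: "measure_pmf.prob D S = (\<Sum>y\<in>A. if y \<in> S then pmf D y else 0)"
    if "set_pmf D \<subseteq> A" for D S
  proof -
    have "measure_pmf.prob D S = measure_pmf.prob D (S \<inter> A)"
      using that by (intro measure_pmf.finite_measure_eq_AE) (auto simp: AE_measure_pmf_iff)
    also have "\<dots> = (\<Sum>y\<in>S \<inter> A. pmf D y)"
      using A by (intro measure_measure_pmf_finite) auto
    also have "\<dots> = (\<Sum>y\<in>A. if y \<in> S then pmf D y else 0)"
      using A by (subst sum.inter_restrict[symmetric]) (auto simp: Int_commute)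
    finally show ?thesis .
  qed
  have one: "(\<Sum>y\<in>A. pmf D y) = 1" if "set_pmf D \<subseteq> A" for D
    using A that by (intro sum_pmf_eq_1)
  \<comment> \<open>All three total masses are 1, and 1 - (1 + 1) / 4 = 1 / 2.\<close>
  have "a / 2 = a * ((\<Sum>y\<in>A. pmf M y) - ((\<Sum>y\<in>A. pmf P y) + (\<Sum>y\<in>A. pmf Q y)) / 4)"
    by (subst (1 2 3) one) (auto simp: A_def)
  also have "\<dots> = (\<Sum>y\<in>A. a * (pmf M y - (pmf P y + pmf Q y) / 4))"
    by (simp add: sum_distrib_left[symmetric] sum_subtractf sum.distrib sum_divide_distrib[symmetric])
  also have "\<dots> \<le> (\<Sum>y\<in>A. min (pmf P y) (pmf Q y))"
    by (intro sum_mono min_ge_square) (use a PQ in auto)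
  also have "\<dots> \<le> (\<Sum>y\<in>A. (if y \<in> {y. T y} then pmf P y else 0)
      + (if y \<in> {y. \<not> T y} then pmf Q y else 0))"
    by (intro sum_mono) auto
  also have "\<dots> = measure_pmf.prob P {y. T y} + measure_pmf.prob Q {y. \<not> T y}"
    by (subst (1 2) prob) (auto simp: A_def sum.distrib)
  finally show ?thesis .
qed

text \<open>Tensorisation: the hypothesis of \<open>two_point_testing\<close> passes from
  coordinates to product laws. If \<open>y\<close> is not \<open>dflt\<close> somewhere off
  \<open>A\<close>, both sides vanish.\<close>

lemma pmf_Pi_pmf_mult:
  fixes c :: "'a \<Rightarrow> real"
  assumes "finite A"
    and "\<And>i y. i \<in> A \<Longrightarrow> pmf (P i) y * pmf (Q i) y = c i * (pmf (M i) y)\<^sup>2"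
  shows "pmf (Pi_pmf A dflt P) y * pmf (Pi_pmf A dflt Q) y =
    (\<Prod>i\<in>A. c i) * (pmf (Pi_pmf A dflt M) y)\<^sup>2"
  using assms by (auto simp: pmf_Pi prod.distrib[symmetric] prod_power_distrib)

lemma finite_set_Pi_pmf_bool:
  fixes P :: "'a \<Rightarrow> bool pmf"
  assumes "finite A"
  shows "finite (set_pmf (Pi_pmf A dflt P))"
  using assms by (intro finite_subset[OF set_Pi_pmf_subset'] finite_PiE_dflt) auto

definition noisy_labels :: "nat \<Rightarrow> real \<Rightarrow> (nat \<Rightarrow> bool) \<Rightarrow> (nat \<Rightarrow> bool) pmf" where
  "noisy_labels n \<delta> s = Pi_pmf {..<n} False
    (\<lambda>i. bernoulli_pmf (if s i then (1 + \<delta>) / 2 else (1 - \<delta>) / 2))"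

text \<open>On a flipped coordinate the two masses multiply to
  \<open>(1 - \<delta>\<^sup>2) / 4\<close> for either label, so the normalised geometric mean is a
  fair coin; elsewhere the laws agree. The squared affinity is thus a power of
  \<open>1 - \<delta>\<^sup>2\<close>, bounded below by Bernoulli's inequality.\<close>

lemma flipped_labels_testing:
  fixes \<delta> :: real and s s' :: "nat \<Rightarrow> bool"
  assumes \<delta>: "0 \<le> \<delta>" "\<delta> \<le> 1"
    and s': "\<And>i. i < n \<Longrightarrow> s' i \<longleftrightarrow> (if i \<in> J then \<not> s i else s i)"
  shows "measure_pmf.prob (noisy_labels n \<delta> s) {y. T y} + measure_pmf.prob (noisy_labels n \<delta> s') {y. \<not> T y}
    \<ge> (1 - real (card ({..<n} \<inter> J)) * \<delta>\<^sup>2) / 2"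
proof -
  define M where "M = Pi_pmf {..<n} False
    (\<lambda>i. bernoulli_pmf (if i \<in> J then 1 / 2 else if s i then (1 + \<delta>) / 2 else (1 - \<delta>) / 2))"
  define a where "a = (\<Prod>i<n. if i \<in> J then 1 - \<delta>\<^sup>2 else 1)"
  have \<delta>2: "\<delta>\<^sup>2 \<le> 1" using \<delta> by (simp add: power_le_one)
  have "a = (1 - \<delta>\<^sup>2) ^ card ({..<n} \<inter> J)"
    unfolding a_def by (subst prod.inter_restrict[symmetric]) auto
  also have "\<dots> \<ge> 1 - real (card ({..<n} \<inter> J)) * \<delta>\<^sup>2"
    using Bernoulli_inequality[of "- \<delta>\<^sup>2" "card ({..<n} \<inter> J)"] \<delta>2 by simp
  finally have a: "a \<ge> 1 - real (card ({..<n} \<inter> J)) * \<delta>\<^sup>2" .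
  have "pmf (noisy_labels n \<delta> s) y * pmf (noisy_labels n \<delta> s') y = a * (pmf M y)\<^sup>2" for y
    unfolding noisy_labels_def M_def a_def
  proof (rule pmf_Pi_pmf_mult)
    fix i y assume "i \<in> {..<n}"
    then have "s' i \<longleftrightarrow> (if i \<in> J then \<not> s i else s i)" using s' by simp
    then show "pmf (bernoulli_pmf (if s i then (1 + \<delta>) / 2 else (1 - \<delta>) / 2)) y *
        pmf (bernoulli_pmf (if s' i then (1 + \<delta>) / 2 else (1 - \<delta>) / 2)) y =
      (if i \<in> J then 1 - \<delta>\<^sup>2 else 1) *
      (pmf (bernoulli_pmf (if i \<in> J then 1 / 2
        else if s i then (1 + \<delta>) / 2 else (1 - \<delta>) / 2)) y)\<^sup>2"
      using \<delta> by (cases y) (auto simp: power2_eq_square field_simps)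
  qed simp
  then have "measure_pmf.prob (noisy_labels n \<delta> s) {y. T y} + measure_pmf.prob (noisy_labels n \<delta> s') {y. \<not> T y} \<ge> a / 2"
    using \<delta>2 by (intro two_point_testing[where M = M])
      (auto simp: noisy_labels_def M_def a_def finite_set_Pi_pmf_bool intro!: prod_nonneg)
  then show ?thesis using a by simp
qed

section \<open>Averaging over labellings and counting repetitions\<close>

text \<open>Toggling \<open>j\<close> is an involution of \<open>Pow V\<close>, so the sum over all
  pairs counts every labelling twice.\<close>

lemma sum_Pow_flip:
  fixes f :: "nat set \<Rightarrow> real"
  assumes j: "j \<in> V" and V: "finite V"
    and f: "\<And>b. b \<subseteq> V \<Longrightarrow> f b + f (sym_diff b {j}) \<ge> c"
  shows "(\<Sum>b\<in>Pow V. f b) \<ge> c / 2 * card (Pow V)"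
proof -
  have "(\<Sum>b\<in>Pow V. f (sym_diff b {j})) = (\<Sum>b\<in>Pow V. f b)"
    by (rule sum.reindex_bij_witness[of _ "\<lambda>b. sym_diff b {j}" "\<lambda>b. sym_diff b {j}"])
      (use j in auto)
  then have "2 * (\<Sum>b\<in>Pow V. f b) = (\<Sum>b\<in>Pow V. f b + f (sym_diff b {j}))"
    by (simp add: sum.distrib)
  also have "\<dots> \<ge> (\<Sum>b\<in>Pow V. c)"
    by (intro sum_mono) (use f in auto)
  finally show ?thesis by (simp add: mult.commute)
qed

text \<open>Within a residue class \<open>i\<close> is determined by \<open>i div V\<close>. This
  bounds how often the cyclic design repeats a point.\<close>

lemma card_residue_le:
  "card {i. i < n \<and> i mod V = j} \<le> n div V + (1::nat)"
proof -
  have "inj_on (\<lambda>i. i div V) {i. i < n \<and> i mod V = j}"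
    by (intro inj_onI) (metis (mono_tags, lifting) div_mult_mod_eq mem_Collect_eq)
  moreover have "(\<lambda>i. i div V) ` {i. i < n \<and> i mod V = j} \<subseteq> {..n div V}"
    by (auto intro: div_le_mono)
  ultimately have "card {i. i < n \<and> i mod V = j} \<le> card {..n div V}"
    by (rule card_inj_on_le) simp
  then show ?thesis by simp
qed

section \<open>Excess risk when all margins are equal\<close>

lemma success_prob_log_odds:
  fixes \<delta> :: real
  assumes \<delta>: "0 < \<delta>" "\<delta> < 1"
    and "\<beta> \<bullet> row X i = (if s then 1 else -1) * ln ((1 + \<delta>) / (1 - \<delta>))"
  shows "success_prob X \<beta> i = (if s then (1 + \<delta>) / 2 else (1 - \<delta>) / 2)"
proof -
  have "exp (ln ((1 + \<delta>) / (1 - \<delta>))) = (1 + \<delta>) / (1 - \<delta>)" using \<delta> by simp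
  then show ?thesis
    using assms by (auto simp: success_prob_eq exp_minus field_simps)
qed

text \<open>On each row the Bayes label errs with probability \<open>(1 - \<delta>) / 2\<close> and
  the opposite label with \<open>(1 + \<delta>) / 2\<close>. Hence every disagreement with
  \<open>s\<close> costs exactly \<open>\<delta> / n\<close>.\<close>

lemma excess_risk_constant_margin:
  fixes \<delta> :: real
  assumes \<delta>: "0 < \<delta>" "\<delta> < 1" and n: "dim_row X = n" "0 < n" and dim: "\<beta> \<in> carrier_vec (dim_col X)"
    and margin: "\<And>i. i < n \<Longrightarrow> \<beta> \<bullet> row X i = (if s i then 1 else -1) * ln ((1 + \<delta>) / (1 - \<delta>))"
  shows "label_pmf X \<beta> = noisy_labels n \<delta> s" (is ?law)
    and "excess_risk X \<beta> \<eta> =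
      \<delta> / n * (\<Sum>i<n. measure_pmf.prob (label_pmf X \<beta>) {y. \<eta> y (row X i) \<noteq> s i})" (is ?excess)
proof -
  have h: "ln ((1 + \<delta>) / (1 - \<delta>)) > 0" using \<delta> by simp
  note p = success_prob_log_odds[OF \<delta> margin]
  show ?law unfolding label_pmf_def noisy_labels_def n by (intro Pi_pmf_cong) (auto simp: p)
  have fin: "finite (set_pmf (label_pmf X \<beta>))"
    unfolding label_pmf_def by (simp add: finite_set_Pi_pmf_bool)
  have risk: "risk X \<beta> \<phi> = (1 - \<delta>) / 2 + \<delta> / n * (\<Sum>i<n. of_bool (\<phi> (row X i) \<noteq> s i))" for \<phi>
  proof -
    have "risk X \<beta> \<phi> = (\<Sum>i<n. (1 - \<delta>) / 2 + \<delta> * of_bool (\<phi> (row X i) \<noteq> s i)) / n"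
      unfolding risk_def n
    proof (intro arg_cong2[where f = "(/)"] sum.cong refl)
      fix i assume "i \<in> {..<n}"
      then show "measure_pmf.prob (label_pmf X \<beta>) {y. y i \<noteq> \<phi> (row X i)} =
          (1 - \<delta>) / 2 + \<delta> * of_bool (\<phi> (row X i) \<noteq> s i)"
        using prob_label[of i X \<beta> "\<phi> (row X i)"] n p[of i] by (auto simp: field_simps)
    qed
    also have "\<dots> = (1 - \<delta>) / 2 + \<delta> / n * (\<Sum>i<n. of_bool (\<phi> (row X i) \<noteq> s i))"
      using n(2) unfolding sum.distrib sum_distrib_left[symmetric] by (simp add: add_divide_distrib)
    finally show ?thesis .
  qed
  have "bayes_classifier \<beta> (row X i) = s i" if "i < n" for i
    using h margin[OF that] by (simp add: bayes_classifier_def)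
  then have bayes: "risk X \<beta> (bayes_classifier \<beta>) = (1 - \<delta>) / 2"
    by (simp add: risk)
  have int: "integrable (measure_pmf (label_pmf X \<beta>)) f" for f :: "(nat \<Rightarrow> bool) \<Rightarrow> real"
    using fin by (rule integrable_measure_pmf_finite)
  have "(\<lambda>y. of_bool (\<eta> y (row X i) \<noteq> s i)) =
      (indicator {y. \<eta> y (row X i) \<noteq> s i} :: (nat \<Rightarrow> bool) \<Rightarrow> real)" for i
    by (auto simp: indicator_def)
  then have "measure_pmf.expectation (label_pmf X \<beta>) (\<lambda>y. of_bool (\<eta> y (row X i) \<noteq> s i)) =
      measure_pmf.prob (label_pmf X \<beta>) {y. \<eta> y (row X i) \<noteq> s i}" for i
    by (simp only:) simp
  then show ?excess
    unfolding excess_risk_def bayes unfolding risk by (simp add: int del: sum_of_bool_eq)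
qed

section \<open>A sparse shattered set of points\<close>

text \<open>
  The features form \<open>k\<close> blocks and each block serves \<open>L\<close> points: its features run through all sign
  patterns on these points up to a global sign, normalised to be \<open>+1\<close> at the last point. The
  coefficient vector selects one feature per block, with coefficient \<open>\<plusminus>1\<close>.
\<close>

lemma sparse_shattering:
  fixes k L d :: nat
  assumes L: "0 < L" and d: "k * 2 ^ (L - 1) \<le> d"
  obtains x :: "nat \<Rightarrow> real vec" and u :: "nat set \<Rightarrow> real vec"
  where "\<And>j. x j \<in> carrier_vec d" "\<And>b. u b \<in> carrier_vec d" "\<And>b. l0_norm (u b) \<le> k"
    "\<And>b j. j < k * L \<Longrightarrow> u b \<bullet> x j = (if j \<in> b then 1 else -1)"
proof -
  define M :: nat where "M = 2 ^ (L - 1)"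
  have M: "M > 0" by (simp add: M_def)
  have "\<exists>e. bij_betw e {0..<M} (Pow {..<L - 1})"
    using ex_bij_betw_nat_finite[of "Pow {..<L - 1}"] by (simp add: M_def card_Pow)
  then obtain e where e: "e ` {0..<M} = Pow {..<L - 1}"
    by (auto simp: bij_betw_def)
  \<comment> \<open>Labels relative to the last point of the block: with that sign factored out,
    \<open>L - 1\<close> bits remain, which is why \<open>M\<close> patterns suffice.\<close>
  define S where "S b a = {l. l < L - 1 \<and> (a * L + l \<in> b \<longleftrightarrow> a * L + (L - 1) \<in> b)}"
    for b a
  have "\<exists>c<M. e c = S b a" for b a
  proof -
    have "S b a \<in> e ` {0..<M}" unfolding e by (auto simp: S_def)
    then show ?thesis by auto
  qed
  then obtain c where c: "c b a < M" "e (c b a) = S b a" for b a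
    by metis
  \<comment> \<open>Feature \<open>i\<close> belongs to block \<open>i div M\<close> and carries
    pattern number \<open>i mod M\<close>. Features from \<open>k * M\<close> on vanish at all
    points \<open>j < k * L\<close>.\<close>
  define x :: "nat \<Rightarrow> real vec" where "x j = vec d (\<lambda>i. if i div M = j div L
    then (if j mod L = L - 1 \<or> j mod L \<in> e (i mod M) then 1 else -1) else 0)" for j
  define u :: "nat set \<Rightarrow> real vec" where "u b = vec d (\<lambda>i. if i < k * M \<and> i mod M = c b (i div M)
    then (if (i div M) * L + (L - 1) \<in> b then 1 else -1) else 0)" for b
  show thesis
  proof
    show "x j \<in> carrier_vec d" for j by (simp add: x_def)
    show "u b \<in> carrier_vec d" for b by (simp add: u_def)
    show "l0_norm (u b) \<le> k" for b
    proof -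
      let ?N = "{i. i < dim_vec (u b) \<and> u b $ i \<noteq> 0}"
      have N: "i < k * M \<and> i mod M = c b (i div M)" if "i \<in> ?N" for i
        using that by (auto simp: u_def split: if_splits)
      have "inj_on (\<lambda>i. i div M) ?N"
        by (intro inj_onI) (metis N div_mult_mod_eq)
      moreover have "(\<lambda>i. i div M) ` ?N \<subseteq> {..<k}"
        using N by (auto simp: less_mult_imp_div_less)
      ultimately have "card ?N \<le> card {..<k}"
        by (rule card_inj_on_le) simp
      then show ?thesis by (simp add: l0_norm_def)
    qed
    show "u b \<bullet> x j = (if j \<in> b then 1 else -1)" if j: "j < k * L" for b j
    proof -
      define a l where "a = j div L" and "l = j mod L"
      have j_eq: "j = a * L + l" and l: "l < L" using L by (auto simp: a_def l_def)
      have a: "a < k" using j by (simp add: a_def less_mult_imp_div_less)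
      define i where "i = a * M + c b a"
      have i: "i div M = a" "i mod M = c b a" using c(1)[of b a] by (auto simp: i_def)
      have "i < Suc a * M" using c(1)[of b a] by (simp add: i_def)
      also have "\<dots> \<le> k * M" using a by (intro mult_le_mono1) simp
      finally have ik: "i < k * M" .
      then have id: "i < d" using d by (simp add: M_def)
      have "u b \<bullet> x j = (\<Sum>i'\<in>{0..<d}. u b $ i' * x j $ i')"
        by (simp add: scalar_prod_def x_def)
      also have "\<dots> = (\<Sum>i'\<in>{i}. u b $ i' * x j $ i')"
      proof (rule sum.mono_neutral_right)
        show "\<forall>i'\<in>{0..<d} - {i}. u b $ i' * x j $ i' = 0"
        proof
          fix i' assume i': "i' \<in> {0..<d} - {i}"
          \<comment> \<open>Block and pattern number determine a feature, so any other one is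
            unselected or lies in a different block.\<close>
          have "\<not> (i' mod M = c b (i' div M) \<and> i' div M = a)"
            using i' i by (metis DiffD2 div_mult_mod_eq singletonI)
          then show "u b $ i' * x j $ i' = 0"
            using i' by (auto simp: u_def x_def a_def)
        qed
      qed (use id in auto)
      also have "\<dots> = u b $ i * x j $ i" by simp
      also have "u b $ i = (if a * L + (L - 1) \<in> b then 1 else -1)"
        using id ik i by (simp add: u_def)
      also have "x j $ i = (if l = L - 1 \<or> l \<in> S b a then 1 else -1)"
        using id i c by (simp add: x_def flip: a_def l_def)
      \<comment> \<open>The sign of the last point times the agreement with it recovers the sign of
        \<open>j\<close>.\<close>
      also have "(if a * L + (L - 1) \<in> b then 1 else -1) *
          (if l = L - 1 \<or> l \<in> S b a then 1 else -1) = (if j \<in> b then 1 else - 1 :: real)"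
        using l by (auto simp: S_def j_eq)
      finally show ?thesis .
    qed
  qed
qed

section \<open>Lower bound for the average excess risk\<close>

lemma average_excess_risk:
  fixes \<delta> :: real and V n d :: nat
  assumes X: "X \<in> carrier_mat n d" and V: "0 < V" "V \<le> n" and \<beta>: "\<And>b. \<beta> b \<in> carrier_vec d"
    and \<delta>_def: "\<delta> = sqrt (real V / (4 * real n))"
    and margin: "\<And>b i. i < n \<Longrightarrow>
      \<beta> b \<bullet> row X i = (if i mod V \<in> b then 1 else -1) * ln ((1 + \<delta>) / (1 - \<delta>))"
  shows "\<exists>b. sqrt (V / n) / 16 \<le> excess_risk X (\<beta> b) \<eta>"
proof -
  have n: "0 < n" using V by simp
  have \<delta>_eq: "\<delta> = sqrt (V / n) / 2"
    unfolding \<delta>_def by (simp add: real_sqrt_divide real_sqrt_mult)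
  have \<delta>: "0 < \<delta>" "\<delta> < 1"
    using V by (auto simp: \<delta>_def)
  have \<delta>2: "\<delta>\<^sup>2 = V / (4 * n)" by (simp add: \<delta>_def)
  define s where "s b i \<longleftrightarrow> i mod V \<in> b" for b i
  define f where "f i b = measure_pmf.prob (noisy_labels n \<delta> (s b)) {y. \<eta> y (row X i) \<noteq> s b i}"
    for i b
  have excess: "excess_risk X (\<beta> b) \<eta> = \<delta> / n * (\<Sum>i<n. f i b)" for b
  proof -
    have "\<beta> b \<bullet> row X i = (if s b i then 1 else -1) * ln ((1 + \<delta>) / (1 - \<delta>))" if "i < n" for i
      using margin[OF that] by (simp add: s_def)
    from excess_risk_constant_margin[OF \<delta> _ n _ this] X \<beta>
    show ?thesis by (simp add: f_def)
  qed
  have f: "(\<Sum>b\<in>Pow {..<V}. f i b) \<ge> 1 / 8 * card (Pow {..<V})" if i: "i < n" for i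
  proof -
    define J where "J = {i'. i' mod V = i mod V}"
    have "real (card ({..<n} \<inter> J)) \<le> real (n div V + 1)"
      using card_residue_le[of n V "i mod V"]
      by (simp add: J_def Collect_conj_eq lessThan_def flip: of_nat_le_iff)
    \<comment> \<open>Since \<open>V \<le> n\<close>, the extra 1 is at most
      \<open>n / V\<close>.\<close>
    also have "\<dots> \<le> 2 * (n / V)"
    proof -
      have "real ((n div V) * V) \<le> real n" by (intro of_nat_mono) simp
      then have "(real (n div V) + 1) * V \<le> 2 * n" using V by (simp add: distrib_right)
      then show ?thesis using V by (simp add: field_simps)
    qed
    finally have "real (card ({..<n} \<inter> J)) * \<delta>\<^sup>2 \<le> 2 * (n / V) * \<delta>\<^sup>2"
      by (intro mult_right_mono) auto
    also have "\<dots> = 1 / 2" using V n by (simp add: \<delta>2)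
    finally have J: "real (card ({..<n} \<inter> J)) * \<delta>\<^sup>2 \<le> 1 / 2" .
    have "f i b + f i (sym_diff b {i mod V}) \<ge> 1 / 4" for b
    proof -
      \<comment> \<open>Toggling \<open>i mod V\<close> flips the Bayes label of row
        \<open>i\<close>, so erring under the new labelling means being right under the old one: the
        two errors of a test.\<close>
      have "f i (sym_diff b {i mod V}) = measure_pmf.prob
          (noisy_labels n \<delta> (s (sym_diff b {i mod V}))) {y. \<not> (\<eta> y (row X i) \<noteq> s b i)}"
        unfolding f_def by (intro arg_cong2[where f = measure_pmf.prob] refl) (auto simp: s_def)
      then have "f i b + f i (sym_diff b {i mod V}) \<ge> (1 - real (card ({..<n} \<inter> J)) * \<delta>\<^sup>2) / 2"
        using flipped_labels_testing[of \<delta> n "s (sym_diff b {i mod V})" J "s b"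
            "\<lambda>y. \<eta> y (row X i) \<noteq> s b i"] \<delta>
        by (auto simp: f_def s_def J_def)
      then show ?thesis using J by simp
    qed
    then have "(\<Sum>b\<in>Pow {..<V}. f i b) \<ge> 1 / 4 / 2 * card (Pow {..<V})"
      using V by (intro sum_Pow_flip[where j = "i mod V"]) auto
    then show ?thesis by simp
  qed
  show ?thesis
  \<comment> \<open>If all labellings stayed below \<open>\<delta> / 8\<close>, so would their
    average, but the rowwise bounds \<open>f\<close> make that average at least
    \<open>\<delta> / 8\<close>.\<close>
  proof (rule ccontr)
    assume "\<nexists>b. sqrt (V / n) / 16 \<le> excess_risk X (\<beta> b) \<eta>"
    then have "excess_risk X (\<beta> b) \<eta> < \<delta> / 8" for b
      by (simp add: \<delta>_eq not_le)
    then have "(\<Sum>b\<in>Pow {..<V}. excess_risk X (\<beta> b) \<eta>) < (\<Sum>b\<in>Pow {..<V}. \<delta> / 8)"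
      by (intro sum_strict_mono) auto
    also have "\<dots> = \<delta> / n * (\<Sum>i<n. 1 / 8 * card (Pow {..<V}))"
      using n by simp
    also have "\<dots> \<le> \<delta> / n * (\<Sum>i<n. \<Sum>b\<in>Pow {..<V}. f i b)"
      using \<delta> f by (intro mult_left_mono sum_mono) auto
    also have "\<dots> = (\<Sum>b\<in>Pow {..<V}. excess_risk X (\<beta> b) \<eta>)"
      unfolding excess by (subst sum.swap) (simp add: sum_distrib_left)
    finally show False by simp
  qed
qed

section \<open>Choice of the block length and conclusion\<close>

lemma block_length_bounds:
  fixes d d0 :: nat
  assumes "0 < d0" "d0 \<le> d"
  defines "L \<equiv> nat \<lfloor>log 2 (2 * real d / real d0)\<rfloor>"
  shows "0 < L" "d0 * 2 ^ (L - 1) \<le> d" "real L \<le> log 2 (2 * real d / real d0)"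
    "ln (real d * exp 1 / real d0) \<le> 2 * real L"
proof -
  define q where "q = log 2 (2 * real d / real d0)"
  have q: "q = 1 + log 2 (real d / real d0)"
    using assms by (simp add: q_def log_mult log_divide)
  have r: "real d / real d0 \<ge> 1" using assms by simp
  then have q1: "q \<ge> 1" using zero_le_log_cancel_iff[of 2 "real d / real d0"] by (simp add: q)
  have floor: "\<lfloor>q\<rfloor> \<ge> 1" using q1 by simp
  then have L: "real L = of_int \<lfloor>q\<rfloor>" unfolding L_def q_def[symmetric] by simp
  show L0: "0 < L" using floor unfolding L_def q_def[symmetric] by simp
  show Lq: "real L \<le> log 2 (2 * real d / real d0)"
    unfolding L q_def[symmetric] by (rule of_int_floor_le)
  have "real (L - 1) \<le> log 2 (real d / real d0)" using Lq L0 q unfolding q_def by simp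
  then have "2 powr real (L - 1) \<le> real d / real d0"
    using r by (subst (asm) le_log_iff) auto
  then have "real (d0 * 2 ^ (L - 1)) \<le> real d"
    using assms(1) by (simp add: powr_realpow field_simps)
  then show "d0 * 2 ^ (L - 1) \<le> d" by linarith
  have "ln (real d * exp 1 / real d0) = 1 + ln (real d / real d0)"
    using assms(1,2) by (simp add: ln_mult ln_div)
  also have "ln (real d / real d0) \<le> log 2 (real d / real d0)"
    using r ln_2_less_1 mult_left_le[of "ln 2" "ln (real d / real d0)"] ln_ge_zero[OF r]
    by (simp add: log_def pos_le_divide_eq)
  also have "1 + log 2 (real d / real d0) = q" by (simp add: q)
  \<comment> \<open>Rounding down costs at most a factor 2, because the floor is at least 1.\<close>
  also have "q \<le> 2 * real L" using floor unfolding L by linarith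
  finally show "ln (real d * exp 1 / real d0) \<le> 2 * real L" by simp
qed

theorem theorem2:
  shows "\<exists>C\<^sub>2::real. C\<^sub>2 > 0 \<and>
    (\<forall>n d d\<^sub>0 :: nat. 0 < n \<and> 0 < d \<and> 0 < d\<^sub>0 \<and> d\<^sub>0 \<le> d \<and>
        2 \<le> real d\<^sub>0 * log 2 (2 * real d / real d\<^sub>0) \<and>
        real d\<^sub>0 * log 2 (2 * real d / real d\<^sub>0) \<le> real n \<longrightarrow>
      (\<exists>X\<^sub>0 \<in> carrier_mat n d.
        (INF \<eta>t :: (nat \<Rightarrow> bool) \<Rightarrow> classifier. SUP \<beta> \<in> sparse_agnostic X\<^sub>0 d\<^sub>0.
            ereal (excess_risk X\<^sub>0 \<beta> \<eta>t))
          \<ge> ereal (C\<^sub>2 * sqrt (real d\<^sub>0 * ln (real d * exp 1 / real d\<^sub>0) / real n))))"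
proof (intro exI[of _ "1 / 32"] conjI allI impI)
  fix n d d0 :: nat
  assume "0 < n \<and> 0 < d \<and> 0 < d0 \<and> d0 \<le> d \<and> 2 \<le> real d0 * log 2 (2 * real d / real d0) \<and>
    real d0 * log 2 (2 * real d / real d0) \<le> real n"
  then have n: "0 < n" and d0: "0 < d0" "d0 \<le> d"
    and le_n: "real d0 * log 2 (2 * real d / real d0) \<le> real n" by auto
  define L where "L = nat \<lfloor>log 2 (2 * real d / real d0)\<rfloor>"
  note L = block_length_bounds[OF d0, folded L_def]
  define V where "V = d0 * L"
  have V: "0 < V" using d0 L by (simp add: V_def)
  have "real V \<le> real d0 * log 2 (2 * real d / real d0)"
    unfolding V_def of_nat_mult by (intro mult_left_mono L) simp
  then have Vn: "V \<le> n" using le_n by linarith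
  obtain x u where x: "\<And>j. x j \<in> carrier_vec d" and u: "\<And>b. u b \<in> carrier_vec d"
    and l0: "\<And>b. l0_norm (u b) \<le> d0"
    and ux: "\<And>b j. j < V \<Longrightarrow> u b \<bullet> x j = (if j \<in> b then 1 else -1)"
    using sparse_shattering[OF L(1,2)] unfolding V_def by metis
  define \<delta> where "\<delta> = sqrt (real V / (4 * real n))"
  define h where "h = ln ((1 + \<delta>) / (1 - \<delta>))"
  define X where "X = mat n d (\<lambda>(i, k). x (i mod V) $ k)"
  have X: "X \<in> carrier_mat n d" by (simp add: X_def)
  have row: "row X i = x (i mod V)" if "i < n" for i
    using that x[of "i mod V"] by (auto simp: X_def)
  define \<beta> where "\<beta> b = h \<cdot>\<^sub>v u b" for b
  have \<beta>: "\<beta> b \<in> carrier_vec d" for b using u by (simp add: \<beta>_def)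
  have margin: "\<beta> b \<bullet> row X i = (if i mod V \<in> b then 1 else -1) * ln ((1 + \<delta>) / (1 - \<delta>))"
    if "i < n" for b i
    using that ux[of "i mod V" b] V smult_scalar_prod_distrib[OF u x, of h b "i mod V"]
    by (simp add: \<beta>_def row flip: h_def)
  have sparse: "\<beta> b \<in> sparse_agnostic X d0" for b
  proof -
    have "l0_norm (\<beta> b) \<le> l0_norm (u b)"
      unfolding l0_norm_def by (intro card_mono) (auto simp: \<beta>_def)
    then show ?thesis
      using \<beta>[of b] X l0[of b] bayes_risk_pos[of X "\<beta> b"] n by (auto simp: sparse_agnostic_def)
  qed
  \<comment> \<open>The left-hand radicand is at most \<open>2 * V / n\<close>; relaxing 2 to
    \<open>2\<^sup>2\<close> makes the root cost a factor 2, which turns 1/16 into 1/32.\<close>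
  have "1 / 32 * sqrt (real d0 * ln (real d * exp 1 / real d0) / real n) \<le> sqrt (V / n) / 16"
  proof -
    have "real d0 * ln (real d * exp 1 / real d0) \<le> real d0 * (2 * real L)"
      by (intro mult_left_mono L) simp
    also have "\<dots> \<le> 2\<^sup>2 * real V" by (simp add: V_def)
    finally have "sqrt (real d0 * ln (real d * exp 1 / real d0) / real n) \<le> sqrt (2\<^sup>2 * (V / n))"
      using n by (intro real_sqrt_le_mono) (simp add: divide_right_mono)
    also have "\<dots> = 2 * sqrt (V / n)"
      by (subst real_sqrt_mult) simp
    finally show ?thesis by simp
  qed
  moreover have "\<exists>b. sqrt (V / n) / 16 \<le> excess_risk X (\<beta> b) \<eta>" for \<eta>
    using average_excess_risk[OF X V Vn \<beta> \<delta>_def margin] .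
  ultimately have "\<exists>b. 1 / 32 * sqrt (real d0 * ln (real d * exp 1 / real d0) / real n)
      \<le> excess_risk X (\<beta> b) \<eta>" for \<eta>
    by (meson order_trans)
  \<comment> \<open>Only the labelling \<open>b\<close> depends on the classifier; the design
    \<open>X\<close> was fixed before it, as the order of the quantifiers demands.\<close>
  then show "\<exists>X\<^sub>0 \<in> carrier_mat n d.
      (INF \<eta>t :: (nat \<Rightarrow> bool) \<Rightarrow> classifier. SUP \<beta> \<in> sparse_agnostic X\<^sub>0 d0.
          ereal (excess_risk X\<^sub>0 \<beta> \<eta>t))
        \<ge> ereal (1 / 32 * sqrt (real d0 * ln (real d * exp 1 / real d0) / real n))"
    using sparse by (intro bexI[OF _ X] INF_greatest) (meson SUP_upper2 ereal_less_eq(3))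
qed simp

end
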